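(* Let $J=\big((j_{10},j_{20}),\dots,(j_{1d},j_{2d})\big)\in(\mathbb N\times\mathbb N)^{d+1}$ be admissible uniformity dimensions. Let $\Sigma_J(A)=[a_1,b_1]\cup\dots\cup[a_\ell,b_\ell]$ with $a_1\le b_1<a_2\le b_2<\dots<a_\ell\le b_\ell$, $\ell\in\{1,\dots,d\}$, be the dichotomy spectrum, put $b_0:=-\infty$, $a_{\ell+1}:=\infty$, and let $\{0\}=M_0\subsetneq M_1\subsetneq\dots\subsetneq M_\ell=\mathbb R^d$ be the spectral filtration, i.e. for $i\in\{0,\dots,\ell\}$ $$M_i=\big\{x_0\in\mathbb R^d:\lim_{n\to\infty}e^{-\gamma n}x(n,x_0)=0\big\}\quad\text{for any }\gamma\in(b_i,a_{i+1}).$$ Let $k_i:=\dim M_i$ for $i\in\{0,\dots,\ell\}$. Then $$a_i=\underline\beta_{k_{i-1},\,j_{2k_{i-1}}}\qquad\text{and}\qquad b_i=\overline\beta_{k_i,\,j_{1k_i}},\qquad i\in\{1,\dots,\ell\}.$$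
   Context: Setting. $\mathbb N=\{0,1,2,\dots\}$, $d\in\mathbb N_{>0}$, $\mathbb T=\mathbb N$ or $\mathbb T=\mathbb Z$, and $A:\mathbb T\to\mathrm{GL}(\mathbb R^d)$ is such that $A$ and $n\mapsto A(n)^{-1}$ are bounded. Consider the system $x(n+1)=A(n)x(n)$, $n\in\mathbb T$. For $x_0\in\mathbb R^d$, $x(\cdot,x_0):\mathbb T\to\mathbb R^d$ denotes its solution with $x(0,x_0)=x_0$, i.e. $x(n,x_0)=A(n-1)\cdots A(0)x_0$ for $n>0$ and, if $\mathbb T=\mathbb Z$, $x(n,x_0)=A(n)^{-1}\cdots A(-1)^{-1}x_0$ for $n<0$. $\|\cdot\|$ is a fixed norm on $\mathbb R^d$. For $\gamma\in\mathbb R$ the $\gamma$-shifted system is $x(n+1)=e^{-\gamma}A(n)x(n)$; its solution starting at time $0$ in $x_0$ is $e^{-\gamma n}x(n,x_0)$. For a subspace $L\subseteq\mathbb R^d$, $\mathcal G_j(L)$ is the set of $j$-dimensional subspaces of $L$. A splitting of $\mathbb R^d$ is a pair $(L_1,L_2)$ of subspaces with $L_1\oplus L_2=\mathbb R^d$. Dichotomy with uniformity dimensions. For $(j_1,j_2)\in\mathbb N\times\mathbb N$, the $\gamma$-shifted system has a dichotomy on a splitting $(L_1,L_2)$ with uniformity dimensions $(j_1,j_2)$ if $\bigcup\mathcal G_{j_1}(L_1)=L_1$, $\bigcup\mathcal G_{j_2}(L_2)=L_2$, and there is $\alpha>0$ such that: for each $U_1\in\mathcal G_{j_1}(L_1)$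 there is $C(U_1)>0$ with $\|x(n,x_0)\|\le C(U_1)e^{(\gamma-\alpha)(n-m)}\|x(m,x_0)\|$ for all $m,n\in\mathbb T$, $n\ge m$, $x_0\in U_1$; and for each $U_2\in\mathcal G_{j_2}(L_2)$ there is $C(U_2)>0$ with $\|x(n,x_0)\|\ge C(U_2)e^{(\gamma+\alpha)(n-m)}\|x(m,x_0)\|$ for all $m,n\in\mathbb T$, $n\ge m$, $x_0\in U_2$. Admissibility. For $k,j_1,j_2\in\{0,\dots,d\}$, the pair $(j_1,j_2)$ is $k$-admissible if: $k=0$, $j_1=0$, $j_2\in\{1,\dots,d\}$; or $k\in\{1,\dots,d-1\}$, $j_1\in\{1,\dots,k\}$, $j_2\in\{1,\dots,d-k\}$; or $k=d$, $j_1\in\{1,\dots,d\}$, $j_2=0$. The tuple $J=\big((j_{10},j_{20}),\dots,(j_{1d},j_{2d})\big)$ is called admissible uniformity dimensions if $(j_{1k},j_{2k})$ is $k$-admissible for every $k\in\{0,\dots,d\}$. Resolvent and spectrum. $\rho_J(A)$ is the set of $\gamma\in\mathbb R$ such that the $\gamma$-shifted system has a dichotomy on some splitting $(L_1,L_2)$ with uniformity dimensions $(j_{1k},j_{2k})$, where $k=\dim L_1$. The dichotomy spectrum is $\Sigma_J(A):=\mathbb R\setminus\rho_J(A)$. It is known (spectral theorem of the same paper) that $\Sigma_J(A)$ has the form of a nonempty union of $\ell\le d$ disjoint compact intervals, that the spaces $M_i$ in the claim do not depend on the choice of $\gamma\in(b_i,a_{i+1})$, and that they form a strictly increasing filtration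 from $\{0\}$ to $\mathbb R^d$. Bohl exponents. With $\sup\emptyset:=-\infty$, $\inf\emptyset:=\infty$, for a subspace $U\subseteq\mathbb R^d$ let $$\overline\beta(U):=\inf_{N\in\mathbb N}\sup\Big\{\tfrac1{n-m}\ln\tfrac{\|x(n,x_0)\|}{\|x(m,x_0)\|}:m,n\in\mathbb T,\ n-m>N,\ x_0\in U\setminus\{0\}\Big\},$$ $$\underline\beta(U):=\sup_{N\in\mathbb N}\inf\Big\{\tfrac1{n-m}\ln\tfrac{\|x(n,x_0)\|}{\|x(m,x_0)\|}:m,n\in\mathbb T,\ n-m>N,\ x_0\in U\setminus\{0\}\Big\}.$$ The limiting Bohl exponents are, for $j,k\in\mathbb N$, $$\overline\beta_{k,j}:=\inf_{L\in\mathcal G_k(\mathbb R^d)}\ \sup_{U\in\mathcal G_j(L)}\overline\beta(U),\qquad \underline\beta_{k,j}:=\sup_{L\in\mathcal G_{d-k}(\mathbb R^d)}\ \inf_{U\in\mathcal G_j(L)}\underline\beta(U).$$ *)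

theory Defs
  imports "HOL-Analysis.Analysis"
begin

definition is_norm :: "('a::real_vector \<Rightarrow> real) \<Rightarrow> bool" where
  "is_norm p \<longleftrightarrow>
     (\<forall>x. p x \<ge> 0) \<and> (\<forall>x. p x = 0 \<longleftrightarrow> x = 0) \<and>
     (\<forall>c x. p (c *\<^sub>R x) = \<bar>c\<bar> * p x) \<and> (\<forall>x y. p (x + y) \<le> p x + p y)"

(* Both choices of the time axis are subsets of int. A coefficient function is defined on all
   of int, but only its values on the time set matter: for T = {0..} the solution at n >= 0
   depends only on A 0, ..., A (n - 1). *)
definition bounded_system :: "int set \<Rightarrow> (int \<Rightarrow> real ^ 'n ^ 'n) \<Rightarrow> bool" where
  "bounded_system T A \<longleftrightarrow>
     (T = {0..} \<or> T = UNIV) \<and> (\<forall>n\<in>T. invertible (A n)) \<and>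
     bounded (A ` T) \<and> bounded ((\<lambda>n. matrix_inv (A n)) ` T)"

primrec forward_solution :: "(int \<Rightarrow> real ^ 'n ^ 'n) \<Rightarrow> nat \<Rightarrow> real ^ 'n \<Rightarrow> real ^ 'n" where
  "forward_solution A 0 x = x"
| "forward_solution A (Suc k) x = A (int k) *v forward_solution A k x"

primrec backward_solution :: "(int \<Rightarrow> real ^ 'n ^ 'n) \<Rightarrow> nat \<Rightarrow> real ^ 'n \<Rightarrow> real ^ 'n" where
  "backward_solution A 0 x = x"
| "backward_solution A (Suc k) x = matrix_inv (A (- int (Suc k))) *v backward_solution A k x"

definition solution :: "(int \<Rightarrow> real ^ 'n ^ 'n) \<Rightarrow> int \<Rightarrow> real ^ 'n \<Rightarrow> real ^ 'n" where
  "solution A n x =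
     (if n \<ge> 0 then forward_solution A (nat n) x else backward_solution A (nat (- n)) x)"

lemma solution_0: "solution A 0 x = x"
  by (simp add: solution_def)

lemma solution_step:
  assumes "n \<in> T" "bounded_system T A"
  shows "solution A (n + 1) x = A n *v solution A n x"
proof (cases "n \<ge> 0")
  case True
  then show ?thesis by (simp add: solution_def nat_add_distrib)
next
  case False
  define k where "k = nat (- n - 1)"
  have n: "n = - int (Suc k)" using False by (simp add: k_def)
  have inv: "invertible (A n)" using assms by (auto simp: bounded_system_def)
  have "solution A (n + 1) x = backward_solution A k x"
    by (cases k) (auto simp: solution_def n nat_add_distrib)
  moreover have "solution A n x = matrix_inv (A n) *v backward_solution A k x"
  proof -
    have "nat (- n) = Suc k" using n by simp
    then show ?thesis using False n by (simp add: solution_def)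
  qed
  moreover have "A n ** matrix_inv (A n) = mat 1"
    using inv unfolding invertible_def matrix_inv_def by (rule someI2_ex) blast
  ultimately show ?thesis
    by (simp add: matrix_vector_mul_assoc)
qed

definition grassmannian :: "nat \<Rightarrow> 'a::euclidean_space set \<Rightarrow> 'a set set" where
  "grassmannian j L = {U. subspace U \<and> U \<subseteq> L \<and> dim U = j}"

definition splitting :: "'a::euclidean_space set \<Rightarrow> 'a set \<Rightarrow> bool" where
  "splitting L1 L2 \<longleftrightarrow> subspace L1 \<and> subspace L2 \<and>
     L1 \<inter> L2 = {0} \<and> {x + y |x y. x \<in> L1 \<and> y \<in> L2} = UNIV"

(* The two estimates for the shifted solutions exp (- \<gamma> n) x(n, x0) with rate \<alpha>, multiplied by
   exp (\<gamma> n). *)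
definition has_dichotomy ::
  "(real ^ 'n \<Rightarrow> real) \<Rightarrow> int set \<Rightarrow> (int \<Rightarrow> real ^ 'n ^ 'n) \<Rightarrow> real \<Rightarrow>
   (real ^ 'n) set \<Rightarrow> (real ^ 'n) set \<Rightarrow> nat \<times> nat \<Rightarrow> bool" where
  "has_dichotomy nrm T A \<gamma> L1 L2 j \<longleftrightarrow>
     splitting L1 L2 \<and>
     \<Union> (grassmannian (fst j) L1) = L1 \<and> \<Union> (grassmannian (snd j) L2) = L2 \<and>
     (\<exists>\<alpha>>0.
        (\<forall>U\<in>grassmannian (fst j) L1. \<exists>C>0. \<forall>m\<in>T. \<forall>n\<in>T. n \<ge> m \<longrightarrow> (\<forall>x\<in>U.
           nrm (solution A n x)
             \<le> C * exp ((\<gamma> - \<alpha>) * real_of_int (n - m)) * nrm (solution A m x))) \<and>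
        (\<forall>U\<in>grassmannian (snd j) L2. \<exists>C>0. \<forall>m\<in>T. \<forall>n\<in>T. n \<ge> m \<longrightarrow> (\<forall>x\<in>U.
           nrm (solution A n x)
             \<ge> C * exp ((\<gamma> + \<alpha>) * real_of_int (n - m)) * nrm (solution A m x))))"

definition pair_admissible :: "nat \<Rightarrow> nat \<Rightarrow> nat \<times> nat \<Rightarrow> bool" where
  "pair_admissible d k j \<longleftrightarrow>
     k = 0 \<and> fst j = 0 \<and> snd j \<in> {1..d} \<or>
     k \<in> {1..d - 1} \<and> fst j \<in> {1..k} \<and> snd j \<in> {1..d - k} \<or>
     k = d \<and> fst j \<in> {1..d} \<and> snd j = 0"

(* The (d + 1)-tuple is encoded as a function; its values beyond d are irrelevant. *)
definition admissible_uniformity_dims :: "nat \<Rightarrow> (nat \<Rightarrow> nat \<times> nat) \<Rightarrow> bool" where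
  "admissible_uniformity_dims d J \<longleftrightarrow> (\<forall>k\<le>d. pair_admissible d k (J k))"

definition dichotomy_resolvent ::
  "(real ^ 'n \<Rightarrow> real) \<Rightarrow> int set \<Rightarrow> (int \<Rightarrow> real ^ 'n ^ 'n) \<Rightarrow> (nat \<Rightarrow> nat \<times> nat) \<Rightarrow> real set" where
  "dichotomy_resolvent nrm T A J = {\<gamma>. \<exists>L1 L2. has_dichotomy nrm T A \<gamma> L1 L2 (J (dim L1))}"

definition dichotomy_spectrum ::
  "(real ^ 'n \<Rightarrow> real) \<Rightarrow> int set \<Rightarrow> (int \<Rightarrow> real ^ 'n ^ 'n) \<Rightarrow> (nat \<Rightarrow> nat \<times> nat) \<Rightarrow> real set" where
  "dichotomy_spectrum nrm T A J = - dichotomy_resolvent nrm T A J"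

(* The open interval (b i, a (i + 1)) with the conventions b 0 = -infinity and
   a (l + 1) = infinity; the values b 0 and a (l + 1) of the real sequences are not used. *)
definition spectral_gap :: "nat \<Rightarrow> (nat \<Rightarrow> real) \<Rightarrow> (nat \<Rightarrow> real) \<Rightarrow> nat \<Rightarrow> real set" where
  "spectral_gap l a b i = {\<gamma>. (i = 0 \<or> b i < \<gamma>) \<and> (i = l \<or> \<gamma> < a (Suc i))}"

definition stable_set :: "(int \<Rightarrow> real ^ 'n ^ 'n) \<Rightarrow> real \<Rightarrow> (real ^ 'n) set" where
  "stable_set A \<gamma> =
     {x. (\<lambda>n::nat. exp (- \<gamma> * real n) *\<^sub>R solution A (int n) x) \<longlonglongrightarrow> 0}"

(* In ereal, Sup {} = -infinity and Inf {} = infinity. *)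
definition growth_rates ::
  "(real ^ 'n \<Rightarrow> real) \<Rightarrow> int set \<Rightarrow> (int \<Rightarrow> real ^ 'n ^ 'n) \<Rightarrow> (real ^ 'n) set \<Rightarrow> nat \<Rightarrow> ereal set" where
  "growth_rates nrm T A U N =
     {ereal (1 / real_of_int (n - m) * ln (nrm (solution A n x) / nrm (solution A m x))) |m n x.
        m \<in> T \<and> n \<in> T \<and> n - m > int N \<and> x \<in> U - {0}}"

definition upper_bohl ::
  "(real ^ 'n \<Rightarrow> real) \<Rightarrow> int set \<Rightarrow> (int \<Rightarrow> real ^ 'n ^ 'n) \<Rightarrow> (real ^ 'n) set \<Rightarrow> ereal" where
  "upper_bohl nrm T A U = (INF N. Sup (growth_rates nrm T A U N))"

definition lower_bohl ::
  "(real ^ 'n \<Rightarrow> real) \<Rightarrow> int set \<Rightarrow> (int \<Rightarrow> real ^ 'n ^ 'n) \<Rightarrow> (real ^ 'n) set \<Rightarrow> ereal" where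
  "lower_bohl nrm T A U = (SUP N. Inf (growth_rates nrm T A U N))"

definition upper_limiting_bohl ::
  "(real ^ 'n \<Rightarrow> real) \<Rightarrow> int set \<Rightarrow> (int \<Rightarrow> real ^ 'n ^ 'n) \<Rightarrow> nat \<Rightarrow> nat \<Rightarrow> ereal" where
  "upper_limiting_bohl nrm T A k j =
     (INF L\<in>grassmannian k UNIV. SUP U\<in>grassmannian j L. upper_bohl nrm T A U)"

(* The subtraction on nat is only meaningful for k <= CARD('n). *)
definition lower_limiting_bohl ::
  "(real ^ 'n \<Rightarrow> real) \<Rightarrow> int set \<Rightarrow> (int \<Rightarrow> real ^ 'n ^ 'n) \<Rightarrow> nat \<Rightarrow> nat \<Rightarrow> ereal" where
  "lower_limiting_bohl nrm T A k j =
     (SUP L\<in>grassmannian (CARD('n) - k) UNIV. INF U\<in>grassmannian j L. lower_bohl nrm T A U)"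

end

theory Submission
  imports Defs
begin

text \<open>
  A dichotomy at \<open>\<gamma>\<close> consists of two independent halves: an upper growth bound with a rate below
  \<open>\<gamma>\<close> on \<open>L\<^sub>1\<close>, and a lower growth bound with a rate above \<open>\<gamma>\<close> on \<open>L\<^sub>2\<close>. Solutions
  obeying both bounds vanish, so two subspaces of complementary dimensions with such bounds
  automatically form a splitting (\<open>splitting_if_rate_separated\<close>). Hence halves that come from
  different sources can be combined to a dichotomy, and this is what determines the end points of
  the spectral intervals.

  On the other hand, a bound with rate \<open>r\<close> that is uniform on \<open>U\<close> is the same as a bound on the
  Bohl exponent of \<open>U\<close>, up to an arbitrarily small change of \<open>r\<close>; boundedness of \<open>A\<close> and its
  inverse covers the short time intervals, which the Bohl exponent ignores.

  Let \<open>b\<close> be the right end point of a spectral interval and \<open>k\<close> the dimension of the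
  stable space in the gap to the right of \<open>b\<close>. The dichotomies at points of the gap show that the
  upper limiting Bohl exponent with index \<open>k\<close> is at most \<open>b\<close>. If it were smaller than \<open>b\<close>, some
  \<open>k\<close>-dimensional space would satisfy an upper bound with a rate below \<open>b\<close>. Together with the
  expanding space of a dichotomy in the gap, whose rate is above \<open>b\<close>, this would give a dichotomy
  at \<open>b\<close>, although \<open>b\<close> lies in the spectrum. Left end points are treated in the same way, with the
  roles of the two halves interchanged (\<open>upper_limiting_bohl_eq\<close>, \<open>lower_limiting_bohl_eq\<close>).

  The stable space of a dichotomy at \<open>\<gamma>\<close> is determined by \<open>\<gamma>\<close> and does not change when \<open>\<gamma>\<close> moves
  between the two rates. Therefore its dimension is constant on each gap, and \<open>k\<close> is well defined.
\<close>

section \<open>Norms, matrices and subspaces\<close>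

lemma is_norm_zero: "is_norm p \<Longrightarrow> p 0 = 0"
  by (simp add: is_norm_def)

lemma is_norm_bounded_by_norm:
  fixes p :: "'a::euclidean_space \<Rightarrow> real"
  assumes "is_norm p"
  shows "p x \<le> (\<Sum>b\<in>Basis. p b) * norm x"
proof -
  have sub: "p (\<Sum>b\<in>F. f b) \<le> (\<Sum>b\<in>F. p (f b))" if "finite F" for F :: "'a set" and f
    using that
  proof (induction F)
    case empty
    then show ?case using assms by (simp add: is_norm_zero)
  next
    case (insert y F)
    have "p (f y + (\<Sum>b\<in>F. f b)) \<le> p (f y) + p (\<Sum>b\<in>F. f b)"
      using assms by (simp add: is_norm_def)
    then show ?case using insert by simp
  qed
  have "p x = p (\<Sum>b\<in>Basis. (x \<bullet> b) *\<^sub>R b)" by (simp add: euclidean_representation)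
  also have "\<dots> \<le> (\<Sum>b\<in>Basis. p ((x \<bullet> b) *\<^sub>R b))" by (rule sub) simp
  also have "\<dots> = (\<Sum>b\<in>Basis. \<bar>x \<bullet> b\<bar> * p b)" using assms by (simp add: is_norm_def)
  also have "\<dots> \<le> (\<Sum>b\<in>Basis. norm x * p b)"
    using assms by (intro sum_mono mult_right_mono) (auto simp: Basis_le_norm is_norm_def)
  finally show ?thesis by (simp add: sum_distrib_left mult.commute)
qed

text \<open>By compactness, the continuous function \<open>p\<close> has a positive minimum on the unit sphere.\<close>

lemma is_norm_equivalent_norm:
  fixes p :: "'a::euclidean_space \<Rightarrow> real"
  assumes p: "is_norm p"
  obtains c where "c > 0" "\<And>x. norm x \<le> c * p x" "\<And>x. p x \<le> c * norm x"
proof -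
  define S where "S = (\<Sum>b\<in>Basis. p (b::'a))"
  have S: "p x \<le> S * norm x" for x
    unfolding S_def using is_norm_bounded_by_norm[OF p] .
  have p0: "p x \<ge> 0" for x using p by (simp add: is_norm_def)
  have S0: "S \<ge> 0" unfolding S_def using p0 by (intro sum_nonneg) auto
  have tri: "p (x + y) \<le> p x + p y" for x y using p by (simp add: is_norm_def)
  have diff: "p x - p y \<le> S * dist x y" for x y
    using tri[of "x - y" y] S[of "x - y"] by (simp add: dist_norm)
  have "S-lipschitz_on (sphere 0 1) p"
  proof (rule lipschitz_onI[OF _ S0])
    fix x y :: 'a
    show "dist (p x) (p y) \<le> S * dist x y"
      using diff[of x y] diff[of y x] by (simp add: dist_real_def abs_le_iff dist_commute)
  qed
  then have "continuous_on (sphere 0 1) p" by (rule lipschitz_on_continuous_on)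
  moreover have "sphere (0::'a) 1 \<noteq> {}"
    using nonempty_Basis by (metis SOME_Basis empty_iff mem_sphere_0 norm_Basis)
  ultimately obtain x0 where x0: "x0 \<in> sphere 0 1" "\<And>x. x \<in> sphere 0 1 \<Longrightarrow> p x0 \<le> p x"
    using continuous_attains_inf[of "sphere (0::'a) 1" p] by auto
  have "x0 \<noteq> 0" using x0(1) by auto
  then have m: "p x0 > 0" using p by (simp add: is_norm_def less_le)
  have low: "norm x * p x0 \<le> p x" for x
  proof (cases "x = 0")
    case True
    then show ?thesis using p0 by simp
  next
    case False
    then have "p x0 \<le> p ((1 / norm x) *\<^sub>R x)" by (intro x0(2)) simp
    also have "\<dots> = p x / norm x" using p by (simp add: is_norm_def)
    finally show ?thesis using False by (simp add: field_simps)
  qed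
  show ?thesis
  proof (rule that[of "S + 1 / p x0"])
    show "S + 1 / p x0 > 0" using S0 m by (simp add: add_nonneg_pos)
    show "norm x \<le> (S + 1 / p x0) * p x" for x
    proof -
      have "norm x \<le> 1 / p x0 * p x" using low[of x] m by (simp add: field_simps)
      also have "\<dots> \<le> (S + 1 / p x0) * p x" using S0 p0 by (intro mult_right_mono) auto
      finally show ?thesis .
    qed
    show "p x \<le> (S + 1 / p x0) * norm x" for x
    proof -
      have "p x \<le> S * norm x" by (rule S)
      also have "\<dots> \<le> (S + 1 / p x0) * norm x" using m by (intro mult_right_mono) auto
      finally show ?thesis .
    qed
  qed
qed

lemma bounded_matrices_uniform_bound:
  fixes B :: "'i \<Rightarrow> real ^ 'n ^ 'n"
  assumes p: "is_norm p" and B: "bounded (B ` S)"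
  obtains K where "K \<ge> 1" "\<And>i x. i \<in> S \<Longrightarrow> p (B i *v x) \<le> K * p x"
proof -
  obtain c where c: "c > 0" "\<And>x. norm x \<le> c * p x" "\<And>x. p x \<le> c * norm x"
    using is_norm_equivalent_norm[OF p] by blast
  obtain D where D: "\<And>i. i \<in> S \<Longrightarrow> norm (B i) \<le> D"
    using B by (auto simp: bounded_iff)
  define E where "E = real CARD('n) * real CARD('n) * \<bar>D\<bar>"
  have "p (B i *v x) \<le> (c * E * c + 1) * p x" if i: "i \<in> S" for i x
  proof -
    have comp: "\<bar>B i $ k $ l\<bar> \<le> \<bar>D\<bar>" for k l
    proof -
      have "\<bar>B i $ k $ l\<bar> \<le> norm (B i $ k)" by (rule component_le_norm_cart)
      also have "\<dots> \<le> norm (B i)" by (rule Finite_Cartesian_Product.norm_nth_le)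
      finally show ?thesis using D[OF i] by linarith
    qed
    have "norm (B i *v x) \<le> onorm ((*v) (B i)) * norm x"
      by (rule onorm) (rule matrix_vector_mul_bounded_linear)
    also have "\<dots> \<le> E * norm x"
      unfolding E_def using onorm_le_matrix_component[OF comp] by (intro mult_right_mono) auto
    also have "\<dots> \<le> E * (c * p x)" using c(2) by (intro mult_left_mono) (auto simp: E_def)
    finally have "c * norm (B i *v x) \<le> c * (E * (c * p x))"
      using c(1) by (intro mult_left_mono) auto
    moreover have "p x \<ge> 0" using p by (simp add: is_norm_def)
    ultimately show ?thesis using c(3)[of "B i *v x"] by (simp add: algebra_simps)
  qed
  moreover have "c * E * c + 1 \<ge> 1" using c(1) by (simp add: E_def)
  ultimately show ?thesis using that by blast
qed

lemma matrix_inv_left_inverse: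
  fixes M :: "real ^ 'n ^ 'n"
  assumes "invertible M"
  shows "matrix_inv M ** M = mat 1"
  using assms unfolding invertible_def matrix_inv_def by (rule someI2_ex) blast

lemma subspace_of_dim_containing:
  fixes L :: "'a::euclidean_space set"
  assumes L: "subspace L" and j: "1 \<le> j" "j \<le> dim L" and x: "x \<in> L"
  obtains U where "U \<in> grassmannian j L" "x \<in> U"
proof -
  define X where "X = (if x = 0 then {} else {x})"
  have X: "X \<subseteq> L" "independent X" "card X \<le> 1" "finite X" "x \<in> span X"
    using x by (auto simp: X_def span_base independent_empty)
  obtain B where B: "X \<subseteq> B" "B \<subseteq> L" "independent B" "L \<subseteq> span B"
    using maximal_independent_subset_extend[OF X(1,2)] by blast
  have card: "card B = dim L" using B by (intro basis_card_eq_dim) auto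
  have fin: "finite B" using B(3) by (rule independent_imp_finite)
  obtain C where C: "X \<subseteq> C" "C \<subseteq> B" "card C = j"
    using exists_subset_between[of X j B] X(3) j card B(1) fin by auto
  have "independent C" using C(2) B(3) independent_mono by blast
  then have "dim (span C) = j" using C(3) by (simp add: dim_eq_card_independent)
  moreover have "span C \<subseteq> L" using C(2) B(2) L by (intro span_minimal) auto
  ultimately have "span C \<in> grassmannian j L" by (simp add: grassmannian_def)
  moreover have "x \<in> span C" using X(5) C(1) span_mono by blast
  ultimately show ?thesis by (rule that)
qed

text \<open>
  Admissible uniformity dimensions are positive unless the space is trivial; this is what makes
  the bounds on the members of the Grassmannian say something about each vector of \<open>L\<close>.
\<close>

lemma Union_grassmannian:
  fixes L :: "'a::euclidean_space set"
  assumes L: "subspace L" and j: "j \<le> dim L" "j = 0 \<Longrightarrow> dim L = 0"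
  shows "\<Union> (grassmannian j L) = L"
proof
  show "\<Union> (grassmannian j L) \<subseteq> L" by (auto simp: grassmannian_def)
  show "L \<subseteq> \<Union> (grassmannian j L)"
  proof
    fix x assume x: "x \<in> L"
    show "x \<in> \<Union> (grassmannian j L)"
    proof (cases "j = 0")
      case True
      then have "L \<in> grassmannian j L" using L j by (simp add: grassmannian_def)
      then show ?thesis using x by blast
    next
      case False
      then have "1 \<le> j" by simp
      then obtain U where "U \<in> grassmannian j L" "x \<in> U"
        using subspace_of_dim_containing[OF L _ j(1) x] by blast
      then show ?thesis by blast
    qed
  qed
qed

lemma Union_grassmannian_admissible:
  fixes L1 L2 :: "(real ^ 'n) set"
  assumes "pair_admissible CARD('n) (dim L1) j" "subspace L1" "subspace L2"
    and "dim L1 + dim L2 = CARD('n)"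
  shows "\<Union> (grassmannian (fst j) L1) = L1" "\<Union> (grassmannian (snd j) L2) = L2"
proof -
  have "fst j \<le> dim L1" "fst j = 0 \<Longrightarrow> dim L1 = 0" "snd j \<le> dim L2" "snd j = 0 \<Longrightarrow> dim L2 = 0"
    using assms(1,4) by (auto simp: pair_admissible_def simp del: dim_eq_0)
  then show "\<Union> (grassmannian (fst j) L1) = L1" "\<Union> (grassmannian (snd j) L2) = L2"
    by (simp_all only: Union_grassmannian[OF assms(2)] Union_grassmannian[OF assms(3)])
qed

lemma splitting_iff_dim:
  fixes L1 L2 :: "(real ^ 'n) set"
  assumes "subspace L1" "subspace L2" "L1 \<inter> L2 = {0}"
  shows "splitting L1 L2 \<longleftrightarrow> dim L1 + dim L2 = CARD('n)"
proof -
  define S where "S = {x + y |x y. x \<in> L1 \<and> y \<in> L2}"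
  have "dim S = dim L1 + dim L2"
    using dim_sums_Int[OF assms(1,2)] assms(3) by (simp add: S_def)
  moreover have "span S = S"
    unfolding span_eq_iff S_def using assms(1,2) by (rule subspace_sums)
  then have "S = UNIV \<longleftrightarrow> dim S = DIM(real ^ 'n)" by (simp only: dim_eq_full)
  ultimately have "S = UNIV \<longleftrightarrow> dim L1 + dim L2 = CARD('n)" by simp
  then show ?thesis using assms by (simp add: splitting_def S_def[symmetric])
qed

section \<open>Growth of solutions\<close>

lemma linear_solution: "linear (solution A n)"
proof -
  have "linear (forward_solution A k)" for k
  proof (induction k)
    case 0
    then show ?case by (simp add: linear_iff)
  next
    case (Suc k)
    then show ?case
      by (simp add: linear_iff matrix_vector_right_distrib matrix_vector_mult_scaleR)
  qed
  moreover have "linear (backward_solution A k)" for k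
  proof (induction k)
    case 0
    then show ?case by (simp add: linear_iff)
  next
    case (Suc k)
    then show ?case
      by (simp add: linear_iff matrix_vector_right_distrib matrix_vector_mult_scaleR)
  qed
  ultimately show ?thesis by (simp add: solution_def linear_iff)
qed

locale bounded_difference_system =
  fixes nrm :: "real ^ 'n \<Rightarrow> real" and T :: "int set" and A :: "int \<Rightarrow> real ^ 'n ^ 'n"
  assumes is_norm: "is_norm nrm" and bounded_system: "bounded_system T A"
begin

lemma nrm_nonneg: "nrm x \<ge> 0"
  using is_norm by (simp add: is_norm_def)

lemma nrm_pos_iff: "nrm x > 0 \<longleftrightarrow> x \<noteq> 0"
  using is_norm by (simp add: is_norm_def less_le)

lemma time_upward_closed: "m \<in> T \<Longrightarrow> m \<le> n \<Longrightarrow> n \<in> T"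
  using bounded_system by (auto simp: bounded_system_def)

lemma time_0: "0 \<in> T"
  using bounded_system by (auto simp: bounded_system_def)

lemma time_of_nat: "int n \<in> T"
  using time_upward_closed[OF time_0] by simp

text \<open>
  The second estimate, which rests on the bound for the inverse matrices, limits how fast solutions
  can decay; it also shows that nonzero solutions never vanish.
\<close>

lemma solution_growth_bounds:
  obtains K where "K \<ge> 1"
    "\<And>m n x. m \<in> T \<Longrightarrow> m \<le> n \<Longrightarrow>
       nrm (solution A n x) \<le> K ^ nat (n - m) * nrm (solution A m x) \<and>
       nrm (solution A m x) \<le> K ^ nat (n - m) * nrm (solution A n x)"
proof -
  obtain K1 where K1: "K1 \<ge> 1" "\<And>n x. n \<in> T \<Longrightarrow> nrm (A n *v x) \<le> K1 * nrm x"
    using bounded_matrices_uniform_bound[OF is_norm, of A T] bounded_system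
    by (auto simp: bounded_system_def)
  obtain K2 where K2: "K2 \<ge> 1" "\<And>n x. n \<in> T \<Longrightarrow> nrm (matrix_inv (A n) *v x) \<le> K2 * nrm x"
    using bounded_matrices_uniform_bound[OF is_norm, of "\<lambda>n. matrix_inv (A n)" T] bounded_system
    by (auto simp: bounded_system_def)
  define K where "K = max K1 K2"
  have step: "nrm (solution A (n + 1) x) \<le> K * nrm (solution A n x)"
    "nrm (solution A n x) \<le> K * nrm (solution A (n + 1) x)" if n: "n \<in> T" for n x
  proof -
    have eq: "solution A (n + 1) x = A n *v solution A n x"
      using solution_step[OF n bounded_system] .
    have "invertible (A n)" using bounded_system n by (auto simp: bounded_system_def)
    then have eq': "solution A n x = matrix_inv (A n) *v solution A (n + 1) x"
      by (simp add: eq matrix_vector_mul_assoc matrix_inv_left_inverse)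
    have "nrm (solution A (n + 1) x) \<le> K1 * nrm (solution A n x)"
      unfolding eq using K1(2)[OF n] .
    also have "\<dots> \<le> K * nrm (solution A n x)"
      using nrm_nonneg by (intro mult_right_mono) (auto simp: K_def)
    finally show "nrm (solution A (n + 1) x) \<le> K * nrm (solution A n x)" .
    have "nrm (solution A n x) \<le> K2 * nrm (solution A (n + 1) x)"
      using K2(2)[OF n, of "solution A (n + 1) x"] eq' by simp
    also have "\<dots> \<le> K * nrm (solution A (n + 1) x)"
      using nrm_nonneg by (intro mult_right_mono) (auto simp: K_def)
    finally show "nrm (solution A n x) \<le> K * nrm (solution A (n + 1) x)" .
  qed
  have K: "K \<ge> 1" using K1(1) by (simp add: K_def)
  have "nrm (solution A n x) \<le> K ^ nat (n - m) * nrm (solution A m x) \<and>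
        nrm (solution A m x) \<le> K ^ nat (n - m) * nrm (solution A n x)"
    if m: "m \<in> T" and "m \<le> n" for m n x
    using \<open>m \<le> n\<close>
  proof (induction n rule: int_ge_induct)
    case base
    then show ?case by simp
  next
    case (step n)
    have n: "n \<in> T" using m step(1) by (rule time_upward_closed)
    have nat: "nat (n + 1 - m) = Suc (nat (n - m))" using step(1) by simp
    have "nrm (solution A (n + 1) x) \<le> K * nrm (solution A n x)" using n by fact
    also have "\<dots> \<le> K * (K ^ nat (n - m) * nrm (solution A m x))"
      using step K by (intro mult_left_mono) auto
    finally have 1: "nrm (solution A (n + 1) x) \<le> K ^ nat (n + 1 - m) * nrm (solution A m x)"
      by (simp add: nat mult.assoc)
    have "nrm (solution A m x) \<le> K ^ nat (n - m) * nrm (solution A n x)" using step by simp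
    also have "\<dots> \<le> K ^ nat (n - m) * (K * nrm (solution A (n + 1) x))"
      using \<open>\<And>x n. n \<in> T \<Longrightarrow> nrm (solution A n x) \<le> K * nrm (solution A (n + 1) x)\<close>[OF n] K
      by (intro mult_left_mono) auto
    finally have 2: "nrm (solution A m x) \<le> K ^ nat (n + 1 - m) * nrm (solution A (n + 1) x)"
      by (simp add: nat mult_ac)
    show ?case using 1 2 by blast
  qed
  then show ?thesis using that K by blast
qed

lemma nrm_solution_pos:
  assumes "n \<in> T" "x \<noteq> 0"
  shows "nrm (solution A n x) > 0"
proof -
  obtain K where K: "K \<ge> 1"
    "\<And>m n x. m \<in> T \<Longrightarrow> m \<le> n \<Longrightarrow>
       nrm (solution A n x) \<le> K ^ nat (n - m) * nrm (solution A m x) \<and>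
       nrm (solution A m x) \<le> K ^ nat (n - m) * nrm (solution A n x)"
    using solution_growth_bounds by blast
  have "\<exists>k. nrm x \<le> K ^ k * nrm (solution A n x)"
  proof (cases "n \<ge> 0")
    case True
    then show ?thesis using K(2)[OF time_0 True, of x] by (auto simp: solution_0)
  next
    case False
    then show ?thesis using K(2)[OF assms(1), of 0 x] by (auto simp: solution_0)
  qed
  then obtain k where k: "nrm x \<le> K ^ k * nrm (solution A n x)" by blast
  have "nrm x > 0" using assms(2) by (simp add: nrm_pos_iff)
  then have "nrm (solution A n x) \<noteq> 0" using k by auto
  then show ?thesis using nrm_nonneg[of "solution A n x"] by linarith
qed

definition grows_at_most :: "(real ^ 'n) set \<Rightarrow> real \<Rightarrow> bool" where
  "grows_at_most U r \<longleftrightarrow> (\<exists>C>0. \<forall>m\<in>T. \<forall>n\<in>T. n \<ge> m \<longrightarrow> (\<forall>x\<in>U.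
     nrm (solution A n x) \<le> C * exp (r * real_of_int (n - m)) * nrm (solution A m x)))"

definition grows_at_least :: "(real ^ 'n) set \<Rightarrow> real \<Rightarrow> bool" where
  "grows_at_least U r \<longleftrightarrow> (\<exists>C>0. \<forall>m\<in>T. \<forall>n\<in>T. n \<ge> m \<longrightarrow> (\<forall>x\<in>U.
     nrm (solution A n x) \<ge> C * exp (r * real_of_int (n - m)) * nrm (solution A m x)))"

lemma grows_at_most_mono:
  assumes "grows_at_most U r" "r \<le> s"
  shows "grows_at_most U s"
proof -
  obtain C where C: "C > 0" "\<And>m n x. m \<in> T \<Longrightarrow> n \<in> T \<Longrightarrow> n \<ge> m \<Longrightarrow> x \<in> U \<Longrightarrow>
     nrm (solution A n x) \<le> C * exp (r * real_of_int (n - m)) * nrm (solution A m x)"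
    using assms(1) unfolding grows_at_most_def by blast
  have "nrm (solution A n x) \<le> C * exp (s * real_of_int (n - m)) * nrm (solution A m x)"
    if "m \<in> T" "n \<in> T" "n \<ge> m" "x \<in> U" for m n x
  proof -
    have "r * real_of_int (n - m) \<le> s * real_of_int (n - m)"
      using assms(2) that by (intro mult_right_mono) auto
    then have "C * exp (r * real_of_int (n - m)) * nrm (solution A m x)
        \<le> C * exp (s * real_of_int (n - m)) * nrm (solution A m x)"
      using C(1) nrm_nonneg by (intro mult_right_mono mult_left_mono) auto
    then show ?thesis using C(2)[OF that] by linarith
  qed
  then show ?thesis using C(1) unfolding grows_at_most_def by blast
qed

lemma grows_at_least_antimono:
  assumes "grows_at_least U s" "r \<le> s"
  shows "grows_at_least U r"
proof -
  obtain C where C: "C > 0" "\<And>m n x. m \<in> T \<Longrightarrow> n \<in> T \<Longrightarrow> n \<ge> m \<Longrightarrow> x \<in> U \<Longrightarrow>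
     nrm (solution A n x) \<ge> C * exp (s * real_of_int (n - m)) * nrm (solution A m x)"
    using assms(1) unfolding grows_at_least_def by blast
  have "nrm (solution A n x) \<ge> C * exp (r * real_of_int (n - m)) * nrm (solution A m x)"
    if "m \<in> T" "n \<in> T" "n \<ge> m" "x \<in> U" for m n x
  proof -
    have "r * real_of_int (n - m) \<le> s * real_of_int (n - m)"
      using assms(2) that by (intro mult_right_mono) auto
    then have "C * exp (r * real_of_int (n - m)) * nrm (solution A m x)
        \<le> C * exp (s * real_of_int (n - m)) * nrm (solution A m x)"
      using C(1) nrm_nonneg by (intro mult_right_mono mult_left_mono) auto
    then show ?thesis using C(2)[OF that] by linarith
  qed
  then show ?thesis using C(1) unfolding grows_at_least_def by blast
qed

section \<open>Growth bounds and Bohl exponents\<close>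

text \<open>
  The constant \<open>C\<close> of a growth bound contributes \<open>ln C / (n - m)\<close> to the growth rate on \<open>[m, n]\<close>,
  which is eventually absorbed by the margin between the two rates.
\<close>

lemma upper_bohl_le:
  assumes U: "grows_at_most U r" and "r < s"
  shows "upper_bohl nrm T A U \<le> ereal s"
proof -
  obtain C where C: "C > 0" "\<And>m n x. m \<in> T \<Longrightarrow> n \<in> T \<Longrightarrow> n \<ge> m \<Longrightarrow> x \<in> U \<Longrightarrow>
     nrm (solution A n x) \<le> C * exp (r * real_of_int (n - m)) * nrm (solution A m x)"
    using U unfolding grows_at_most_def by blast
  obtain N :: nat where N: "real N > ln C / (s - r)" using reals_Archimedean2 by blast
  have "1 / real_of_int (n - m) * ln (nrm (solution A n x) / nrm (solution A m x)) \<le> s"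
    if mn: "m \<in> T" "n \<in> T" "n - m > int N" and x: "x \<in> U - {0}" for m n x
  proof -
    define t where "t = real_of_int (n - m)"
    have t: "t > real N" "t > 0" using mn(3) unfolding t_def by linarith+
    have pos: "nrm (solution A n x) > 0" "nrm (solution A m x) > 0"
      using x mn nrm_solution_pos by auto
    have "nrm (solution A n x) / nrm (solution A m x) \<le> C * exp (r * t)"
      using C(2)[OF mn(1,2), of x] mn(3) x pos by (simp add: t_def divide_le_eq)
    then have "ln (nrm (solution A n x) / nrm (solution A m x)) \<le> ln (C * exp (r * t))"
      using pos by (intro ln_mono) auto
    also have "\<dots> = ln C + r * t" using C(1) by (simp add: ln_mult)
    also have "\<dots> \<le> s * t"
    proof -
      have "ln C / (s - r) < t" using N t by linarith
      then have "ln C < t * (s - r)" using assms(2) by (simp add: divide_less_eq)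
      then show ?thesis by (simp add: algebra_simps)
    qed
    finally show ?thesis using t(2) unfolding t_def[symmetric] by (simp add: divide_le_eq)
  qed
  then have "Sup (growth_rates nrm T A U N) \<le> ereal s"
    by (intro Sup_least) (auto simp: growth_rates_def)
  then show ?thesis unfolding upper_bohl_def by (intro INF_lower2[of N]) auto
qed

lemma lower_bohl_ge:
  assumes U: "grows_at_least U r" and "s < r"
  shows "ereal s \<le> lower_bohl nrm T A U"
proof -
  obtain C where C: "C > 0" "\<And>m n x. m \<in> T \<Longrightarrow> n \<in> T \<Longrightarrow> n \<ge> m \<Longrightarrow> x \<in> U \<Longrightarrow>
     nrm (solution A n x) \<ge> C * exp (r * real_of_int (n - m)) * nrm (solution A m x)"
    using U unfolding grows_at_least_def by blast
  obtain N :: nat where N: "real N > - ln C / (r - s)" using reals_Archimedean2 by blast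
  have "s \<le> 1 / real_of_int (n - m) * ln (nrm (solution A n x) / nrm (solution A m x))"
    if mn: "m \<in> T" "n \<in> T" "n - m > int N" and x: "x \<in> U - {0}" for m n x
  proof -
    define t where "t = real_of_int (n - m)"
    have t: "t > real N" "t > 0" using mn(3) unfolding t_def by linarith+
    have pos: "nrm (solution A n x) > 0" "nrm (solution A m x) > 0"
      using x mn nrm_solution_pos by auto
    have "s * t \<le> ln C + r * t"
    proof -
      have "- ln C / (r - s) < t" using N t by linarith
      then have "- ln C < t * (r - s)"
        by (rule iffD1[OF pos_divide_less_eq, rotated]) (use assms(2) in simp)
      then show ?thesis by (simp add: algebra_simps)
    qed
    also have "\<dots> = ln (C * exp (r * t))" using C(1) by (simp add: ln_mult)
    also have "C * exp (r * t) \<le> nrm (solution A n x) / nrm (solution A m x)"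
      using C(2)[OF mn(1,2), of x] mn(3) x pos by (simp add: t_def le_divide_eq)
    then have "ln (C * exp (r * t)) \<le> ln (nrm (solution A n x) / nrm (solution A m x))"
      using C(1) by (intro ln_mono) auto
    finally show ?thesis using t(2) unfolding t_def[symmetric] by (simp add: le_divide_eq)
  qed
  then have "ereal s \<le> Inf (growth_rates nrm T A U N)"
    by (intro Inf_greatest) (auto simp: growth_rates_def)
  then show ?thesis unfolding lower_bohl_def by (intro SUP_upper2[of N]) auto
qed

text \<open>
  Conversely, the Bohl exponent controls the growth over all time intervals longer than some \<open>N\<close>,
  and over the remaining ones solutions change at most by a factor \<open>K ^ N\<close>. There the other factor
  \<open>exp (\<bar>r\<bar> * N)\<close> of the constant absorbs the exponential in the growth bound.
\<close>

lemma grows_at_most_if_upper_bohl_less: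
  assumes "upper_bohl nrm T A U < ereal r"
  shows "grows_at_most U r"
proof -
  obtain N where N: "Sup (growth_rates nrm T A U N) < ereal r"
    using assms unfolding upper_bohl_def by (auto simp: INF_less_iff)
  obtain K where K: "K \<ge> 1"
    "\<And>m n x. m \<in> T \<Longrightarrow> m \<le> n \<Longrightarrow>
       nrm (solution A n x) \<le> K ^ nat (n - m) * nrm (solution A m x) \<and>
       nrm (solution A m x) \<le> K ^ nat (n - m) * nrm (solution A n x)"
    using solution_growth_bounds by blast
  define C where "C = K ^ N * exp (\<bar>r\<bar> * real N)"
  have C: "C \<ge> 1" unfolding C_def using K(1) mult_mono[of 1 "K ^ N" 1 "exp (\<bar>r\<bar> * real N)"] by simp
  have "nrm (solution A n x) \<le> C * exp (r * real_of_int (n - m)) * nrm (solution A m x)"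
    if mn: "m \<in> T" "n \<in> T" "n \<ge> m" and x: "x \<in> U" for m n x
  proof (cases "x = 0")
    case True
    then show ?thesis
      by (simp add: linear_0[OF linear_solution] is_norm_zero[OF is_norm])
  next
    case False
    define t where "t = real_of_int (n - m)"
    have pos: "nrm (solution A n x) > 0" "nrm (solution A m x) > 0"
      using False mn nrm_solution_pos by auto
    show ?thesis
    proof (cases "n - m > int N")
      case True
      then have t: "t > 0" unfolding t_def by linarith
      have "ereal (1 / t * ln (nrm (solution A n x) / nrm (solution A m x)))
          \<in> growth_rates nrm T A U N"
        unfolding growth_rates_def t_def using mn x False True by blast
      then have "1 / t * ln (nrm (solution A n x) / nrm (solution A m x)) < r"
        using N Sup_upper le_less_trans ereal_less(2) by (metis less_ereal.simps(1))
      then have "ln (nrm (solution A n x) / nrm (solution A m x)) < r * t"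
        using t by (simp add: divide_less_eq)
      then have "exp (ln (nrm (solution A n x) / nrm (solution A m x))) < exp (r * t)"
        by (rule exp_less_mono)
      then have "nrm (solution A n x) / nrm (solution A m x) < exp (r * t)"
        using pos by simp
      then have "nrm (solution A n x) < 1 * exp (r * t) * nrm (solution A m x)"
        using pos by (simp add: divide_less_eq)
      also have "\<dots> \<le> C * exp (r * t) * nrm (solution A m x)"
        using C pos by (intro mult_right_mono) auto
      finally show ?thesis unfolding t_def by simp
    next
      case False
      then have t: "0 \<le> t" "t \<le> real N" "nat (n - m) \<le> N" using mn(3) unfolding t_def by linarith+
      have "\<bar>r\<bar> * t \<le> \<bar>r\<bar> * real N" using t by (intro mult_left_mono) auto
      moreover have "- (r * t) \<le> \<bar>r\<bar> * t"
        using mult_right_mono[OF abs_ge_minus_self[of r] t(1)] by simp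
      ultimately have "1 \<le> exp (\<bar>r\<bar> * real N) * exp (r * t)" by (simp flip: exp_add)
      then have "K ^ N * 1 \<le> K ^ N * (exp (\<bar>r\<bar> * real N) * exp (r * t))"
        using K(1) by (intro mult_left_mono) auto
      moreover have "K ^ nat (n - m) \<le> K ^ N" using t(3) K(1) by (rule power_increasing)
      ultimately have "K ^ nat (n - m) \<le> C * exp (r * t)" by (simp add: C_def mult.assoc)
      then have "K ^ nat (n - m) * nrm (solution A m x) \<le> C * exp (r * t) * nrm (solution A m x)"
        using pos by (intro mult_right_mono) auto
      then show ?thesis using K(2)[OF mn(1,3), of x] unfolding t_def by linarith
    qed
  qed
  then show ?thesis using C unfolding grows_at_most_def by (intro exI[of _ C]) auto
qed

lemma grows_at_least_if_less_lower_bohl: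
  assumes "ereal r < lower_bohl nrm T A U"
  shows "grows_at_least U r"
proof -
  obtain N where N: "ereal r < Inf (growth_rates nrm T A U N)"
    using assms unfolding lower_bohl_def by (auto simp: less_SUP_iff)
  obtain K where K: "K \<ge> 1"
    "\<And>m n x. m \<in> T \<Longrightarrow> m \<le> n \<Longrightarrow>
       nrm (solution A n x) \<le> K ^ nat (n - m) * nrm (solution A m x) \<and>
       nrm (solution A m x) \<le> K ^ nat (n - m) * nrm (solution A n x)"
    using solution_growth_bounds by blast
  define C where "C = K ^ N * exp (\<bar>r\<bar> * real N)"
  have C: "C \<ge> 1" unfolding C_def using K(1) mult_mono[of 1 "K ^ N" 1 "exp (\<bar>r\<bar> * real N)"] by simp
  have "exp (r * real_of_int (n - m)) * nrm (solution A m x) \<le> C * nrm (solution A n x)"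
    if mn: "m \<in> T" "n \<in> T" "n \<ge> m" and x: "x \<in> U" for m n x
  proof (cases "x = 0")
    case True
    then show ?thesis
      by (simp add: linear_0[OF linear_solution] is_norm_zero[OF is_norm])
  next
    case False
    define t where "t = real_of_int (n - m)"
    have pos: "nrm (solution A n x) > 0" "nrm (solution A m x) > 0"
      using False mn nrm_solution_pos by auto
    show ?thesis
    proof (cases "n - m > int N")
      case True
      then have t: "t > 0" unfolding t_def by linarith
      have "ereal (1 / t * ln (nrm (solution A n x) / nrm (solution A m x)))
          \<in> growth_rates nrm T A U N"
        unfolding growth_rates_def t_def using mn x False True by blast
      then have "r < 1 / t * ln (nrm (solution A n x) / nrm (solution A m x))"
        using N Inf_lower less_le_trans by (metis less_ereal.simps(1))
      then have "r * t < ln (nrm (solution A n x) / nrm (solution A m x))"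
        using t by (simp add: less_divide_eq)
      then have "exp (r * t) < exp (ln (nrm (solution A n x) / nrm (solution A m x)))"
        by (rule exp_less_mono)
      then have "exp (r * t) < nrm (solution A n x) / nrm (solution A m x)"
        using pos by simp
      then have "exp (r * t) * nrm (solution A m x) < 1 * nrm (solution A n x)"
        using pos by (simp add: less_divide_eq)
      also have "\<dots> \<le> C * nrm (solution A n x)"
        using C pos by (intro mult_right_mono) auto
      finally show ?thesis unfolding t_def by simp
    next
      case False
      then have t: "0 \<le> t" "t \<le> real N" "nat (n - m) \<le> N" using mn(3) unfolding t_def by linarith+
      have "\<bar>r\<bar> * t \<le> \<bar>r\<bar> * real N" using t by (intro mult_left_mono) auto
      moreover have "r * t \<le> \<bar>r\<bar> * t"
        using mult_right_mono[OF abs_ge_self[of r] t(1)] by simp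
      ultimately have e: "exp (r * t) \<le> exp (\<bar>r\<bar> * real N)" by simp
      have "K ^ nat (n - m) \<le> K ^ N" using t(3) K(1) by (rule power_increasing)
      then have "exp (r * t) * K ^ nat (n - m) \<le> C"
        unfolding C_def mult.commute[of "exp (r * t)"] using e K(1) by (intro mult_mono) auto
      then have "exp (r * t) * K ^ nat (n - m) * nrm (solution A n x) \<le> C * nrm (solution A n x)"
        using pos by (intro mult_right_mono) auto
      moreover have "exp (r * t) * nrm (solution A m x)
          \<le> exp (r * t) * (K ^ nat (n - m) * nrm (solution A n x))"
        using K(2)[OF mn(1,3), of x] by (intro mult_left_mono) auto
      ultimately show ?thesis unfolding t_def mult.assoc by linarith
    qed
  qed
  then have "1 / C * exp (r * real_of_int (n - m)) * nrm (solution A m x) \<le> nrm (solution A n x)"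
    if "m \<in> T" "n \<in> T" "n \<ge> m" "x \<in> U" for m n x
    using that C by (simp add: divide_le_eq mult.commute)
  then show ?thesis using C unfolding grows_at_least_def by (intro exI[of _ "1 / C"]) auto
qed

section \<open>Stable sets\<close>

lemma mem_stable_set_iff:
  "x \<in> stable_set A \<gamma> \<longleftrightarrow> (\<lambda>n. exp (- \<gamma> * real n) * nrm (solution A (int n) x)) \<longlonglongrightarrow> 0"
proof -
  obtain c where c: "c > 0" "\<And>x. norm x \<le> c * nrm x" "\<And>x. nrm x \<le> c * norm x"
    using is_norm_equivalent_norm[OF is_norm] by blast
  let ?f = "\<lambda>n. exp (- \<gamma> * real n) * norm (solution A (int n) x)"
  let ?g = "\<lambda>n. exp (- \<gamma> * real n) * nrm (solution A (int n) x)"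
  have fg: "norm (?f n) \<le> ?g n * c" and gf: "norm (?g n) \<le> ?f n * c" for n
    using c(2,3)[of "solution A (int n) x"] nrm_nonneg
    by (auto simp: abs_mult mult.assoc mult.commute[of _ c] intro!: mult_left_mono)
  have "x \<in> stable_set A \<gamma> \<longleftrightarrow> ?f \<longlonglongrightarrow> 0"
    unfolding stable_set_def mem_Collect_eq
    by (subst tendsto_norm_zero_iff[symmetric]) simp
  also have "\<dots> \<longleftrightarrow> ?g \<longlonglongrightarrow> 0"
  proof
    assume "?f \<longlonglongrightarrow> 0"
    then have "(\<lambda>n. ?f n * c) \<longlonglongrightarrow> 0" by (rule tendsto_mult_left_zero)
    then show "?g \<longlonglongrightarrow> 0" by (rule Lim_null_comparison[rotated]) (use gf in simp)
  next
    assume "?g \<longlonglongrightarrow> 0"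
    then have "(\<lambda>n. ?g n * c) \<longlonglongrightarrow> 0" by (rule tendsto_mult_left_zero)
    then show "?f \<longlonglongrightarrow> 0" by (rule Lim_null_comparison[rotated]) (use fg in simp)
  qed
  finally show ?thesis .
qed

lemma stable_set_diff:
  assumes "x \<in> stable_set A \<gamma>" "y \<in> stable_set A \<gamma>"
  shows "x - y \<in> stable_set A \<gamma>"
  using tendsto_diff[of _ 0 sequentially _ 0] assms
  by (fastforce simp: stable_set_def linear_diff[OF linear_solution] scaleR_diff_right)

lemma grows_at_most_imp_stable:
  assumes "grows_at_most U r" "r < \<gamma>" "x \<in> U"
  shows "x \<in> stable_set A \<gamma>"
proof -
  obtain C where C: "C > 0" "\<And>m n x. m \<in> T \<Longrightarrow> n \<in> T \<Longrightarrow> n \<ge> m \<Longrightarrow> x \<in> U \<Longrightarrow>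
     nrm (solution A n x) \<le> C * exp (r * real_of_int (n - m)) * nrm (solution A m x)"
    using assms(1) unfolding grows_at_most_def by blast
  have "norm (exp (- \<gamma> * real n) * nrm (solution A (int n) x)) \<le> exp (r - \<gamma>) ^ n * (C * nrm x)" for n
  proof -
    have "nrm (solution A (int n) x) \<le> C * exp (r * real n) * nrm x"
      using C(2)[OF time_0 time_of_nat, of n x] assms(3) by (simp add: solution_0)
    then have "exp (- \<gamma> * real n) * nrm (solution A (int n) x)
        \<le> exp (- \<gamma> * real n) * (C * exp (r * real n) * nrm x)"
      by (intro mult_left_mono) auto
    also have "\<dots> = exp (- \<gamma> * real n) * exp (r * real n) * (C * nrm x)"
      by simp
    also have "exp (- \<gamma> * real n) * exp (r * real n) = exp (r - \<gamma>) ^ n"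
      by (simp add: exp_of_nat_mult[symmetric] algebra_simps flip: exp_add)
    finally show ?thesis using nrm_nonneg by simp
  qed
  moreover have "(\<lambda>n. exp (r - \<gamma>) ^ n * (C * nrm x)) \<longlonglongrightarrow> 0"
    using assms(2) by (intro tendsto_mult_left_zero LIMSEQ_power_zero) simp
  ultimately show ?thesis
    unfolding mem_stable_set_iff by (rule Lim_null_comparison[OF always_eventually[OF allI]])
qed

lemma grows_at_least_stable_imp_0:
  assumes "grows_at_least U s" "\<gamma> < s" "x \<in> U" "x \<in> stable_set A \<gamma>"
  shows "x = 0"
proof (rule ccontr)
  assume x: "x \<noteq> 0"
  obtain C where C: "C > 0" "\<And>m n x. m \<in> T \<Longrightarrow> n \<in> T \<Longrightarrow> n \<ge> m \<Longrightarrow> x \<in> U \<Longrightarrow>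
     nrm (solution A n x) \<ge> C * exp (s * real_of_int (n - m)) * nrm (solution A m x)"
    using assms(1) unfolding grows_at_least_def by blast
  have "C * nrm x \<le> exp (- \<gamma> * real n) * nrm (solution A (int n) x)" for n
  proof -
    have "\<gamma> * real n \<le> s * real n" using assms(2) by (intro mult_right_mono) auto
    then have "1 \<le> exp (- \<gamma> * real n) * exp (s * real n)" by (simp flip: exp_add)
    then have "1 * (C * nrm x) \<le> exp (- \<gamma> * real n) * exp (s * real n) * (C * nrm x)"
      using C(1) nrm_nonneg by (intro mult_right_mono) auto
    also have "\<dots> = exp (- \<gamma> * real n) * (C * exp (s * real n) * nrm x)" by simp
    also have "\<dots> \<le> exp (- \<gamma> * real n) * nrm (solution A (int n) x)"
      using C(2)[OF time_0 time_of_nat, of n x] assms(3)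
      by (intro mult_left_mono) (auto simp: solution_0)
    finally show ?thesis by simp
  qed
  then have "C * nrm x \<le> 0"
    using assms(4) unfolding mem_stable_set_iff by (intro LIMSEQ_le_const) auto
  moreover have "C * nrm x > 0" using C(1) x by (simp add: nrm_pos_iff)
  ultimately show False by simp
qed

section \<open>Dichotomies as pairs of growth bounds\<close>

text \<open>
  Complementarity of the two spaces is replaced by the condition on their dimensions, so that
  the halves of different dichotomies can be combined freely.
\<close>

definition rate_separated ::
  "(real ^ 'n) set \<Rightarrow> (real ^ 'n) set \<Rightarrow> nat \<times> nat \<Rightarrow> real \<Rightarrow> real \<Rightarrow> bool" where
  "rate_separated L1 L2 j r s \<longleftrightarrow>
     subspace L1 \<and> subspace L2 \<and> dim L1 + dim L2 = CARD('n) \<and>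
     (\<forall>U\<in>grassmannian (fst j) L1. grows_at_most U r) \<and>
     (\<forall>U\<in>grassmannian (snd j) L2. grows_at_least U s)"

context
  fixes L1 L2 j r s
  assumes sep: "rate_separated L1 L2 j r s" and adm: "pair_admissible CARD('n) (dim L1) j"
begin

lemma rate_separated_stable:
  assumes "r < \<gamma>" "x \<in> L1"
  shows "x \<in> stable_set A \<gamma>"
proof -
  have "x \<in> \<Union> (grassmannian (fst j) L1)"
    using Union_grassmannian_admissible(1)[OF adm, of L2] sep assms(2)
    unfolding rate_separated_def by blast
  then obtain U where U: "U \<in> grassmannian (fst j) L1" "x \<in> U" by blast
  then have "grows_at_most U r" using sep by (simp add: rate_separated_def)
  then show ?thesis using assms(1) U(2) by (rule grows_at_most_imp_stable)
qed

lemma rate_separated_unstable: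
  assumes "\<gamma> < s" "x \<in> L2" "x \<in> stable_set A \<gamma>"
  shows "x = 0"
proof -
  have "x \<in> \<Union> (grassmannian (snd j) L2)"
    using Union_grassmannian_admissible(2)[OF adm, of L2] sep assms(2)
    unfolding rate_separated_def by blast
  then obtain U where U: "U \<in> grassmannian (snd j) L2" "x \<in> U" by blast
  then have "grows_at_least U s" using sep by (simp add: rate_separated_def)
  then show ?thesis using assms(1) U(2) assms(3) by (rule grows_at_least_stable_imp_0)
qed

lemma splitting_if_rate_separated:
  assumes "r < s"
  shows "splitting L1 L2"
proof -
  obtain \<gamma> where \<gamma>: "r < \<gamma>" "\<gamma> < s" using dense[OF assms] by blast
  have "L1 \<inter> L2 \<subseteq> {0}"
    using rate_separated_stable[OF \<gamma>(1)] rate_separated_unstable[OF \<gamma>(2)] by auto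
  moreover have "0 \<in> L1" "0 \<in> L2" using sep by (simp_all add: rate_separated_def subspace_0)
  ultimately have "L1 \<inter> L2 = {0}" by blast
  then show ?thesis using splitting_iff_dim[of L1 L2] sep unfolding rate_separated_def by blast
qed

text \<open>
  The \<open>L2\<close>-component of a stable vector is the difference of two stable vectors, so it is stable
  itself and hence zero.
\<close>

lemma stable_set_eq_if_rate_separated:
  assumes \<gamma>: "r < \<gamma>" "\<gamma> < s"
  shows "stable_set A \<gamma> = L1"
proof
  show "L1 \<subseteq> stable_set A \<gamma>" using rate_separated_stable[OF \<gamma>(1)] by blast
  show "stable_set A \<gamma> \<subseteq> L1"
  proof
    fix x assume x: "x \<in> stable_set A \<gamma>"
    have "x \<in> {x + y |x y. x \<in> L1 \<and> y \<in> L2}"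
      using splitting_if_rate_separated \<gamma> by (simp add: splitting_def)
    then obtain y z where yz: "x = y + z" "y \<in> L1" "z \<in> L2" by blast
    have "x - y \<in> stable_set A \<gamma>"
      using x rate_separated_stable[OF \<gamma>(1) yz(2)] by (rule stable_set_diff)
    then have "z = 0" using yz rate_separated_unstable[OF \<gamma>(2)] by simp
    then show "x \<in> L1" using yz by simp
  qed
qed

end

lemma has_dichotomy_iff_growth:
  "has_dichotomy nrm T A \<gamma> L1 L2 j \<longleftrightarrow> splitting L1 L2 \<and>
     \<Union> (grassmannian (fst j) L1) = L1 \<and> \<Union> (grassmannian (snd j) L2) = L2 \<and>
     (\<exists>\<alpha>>0. (\<forall>U\<in>grassmannian (fst j) L1. grows_at_most U (\<gamma> - \<alpha>)) \<and>
            (\<forall>U\<in>grassmannian (snd j) L2. grows_at_least U (\<gamma> + \<alpha>)))"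
  unfolding has_dichotomy_def grows_at_most_def grows_at_least_def ..

lemma has_dichotomy_iff_rate_separated:
  assumes adm: "pair_admissible CARD('n) (dim L1) j"
  shows "has_dichotomy nrm T A \<gamma> L1 L2 j \<longleftrightarrow>
    (\<exists>r s. r < \<gamma> \<and> \<gamma> < s \<and> rate_separated L1 L2 j r s)"
proof
  assume D: "has_dichotomy nrm T A \<gamma> L1 L2 j"
  then obtain \<alpha> where \<alpha>: "\<alpha> > 0" "\<forall>U\<in>grassmannian (fst j) L1. grows_at_most U (\<gamma> - \<alpha>)"
    "\<forall>U\<in>grassmannian (snd j) L2. grows_at_least U (\<gamma> + \<alpha>)"
    unfolding has_dichotomy_iff_growth by blast
  have spl: "splitting L1 L2" using D by (simp add: has_dichotomy_def)
  then have sub: "subspace L1" "subspace L2" "L1 \<inter> L2 = {0}" by (simp_all add: splitting_def)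
  have "rate_separated L1 L2 j (\<gamma> - \<alpha>) (\<gamma> + \<alpha>)"
    using \<alpha> sub splitting_iff_dim[OF sub] spl by (simp add: rate_separated_def)
  then show "\<exists>r s. r < \<gamma> \<and> \<gamma> < s \<and> rate_separated L1 L2 j r s"
    using \<alpha>(1) by (intro exI[of _ "\<gamma> - \<alpha>"] exI[of _ "\<gamma> + \<alpha>"]) simp
next
  assume "\<exists>r s. r < \<gamma> \<and> \<gamma> < s \<and> rate_separated L1 L2 j r s"
  then obtain r s where rs: "r < \<gamma>" "\<gamma> < s" and sep: "rate_separated L1 L2 j r s" by blast
  define \<alpha> where "\<alpha> = min (\<gamma> - r) (s - \<gamma>)"
  have \<alpha>: "\<alpha> > 0" "r \<le> \<gamma> - \<alpha>" "\<gamma> + \<alpha> \<le> s" using rs by (auto simp: \<alpha>_def)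
  have spl: "splitting L1 L2" using splitting_if_rate_separated[OF sep adm] rs by simp
  have "\<Union> (grassmannian (fst j) L1) = L1" "\<Union> (grassmannian (snd j) L2) = L2"
    using Union_grassmannian_admissible[OF adm, of L2] sep unfolding rate_separated_def by blast+
  moreover have "\<forall>U\<in>grassmannian (fst j) L1. grows_at_most U (\<gamma> - \<alpha>)"
    using sep grows_at_most_mono[OF _ \<alpha>(2)] by (simp add: rate_separated_def)
  moreover have "\<forall>U\<in>grassmannian (snd j) L2. grows_at_least U (\<gamma> + \<alpha>)"
    using sep grows_at_least_antimono[OF _ \<alpha>(3)] by (simp add: rate_separated_def)
  ultimately show "has_dichotomy nrm T A \<gamma> L1 L2 j"
    using spl \<alpha>(1) unfolding has_dichotomy_iff_growth by blast
qed

section \<open>End points of spectral gaps\<close>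

context
  fixes J :: "nat \<Rightarrow> nat \<times> nat"
  assumes J: "admissible_uniformity_dims CARD('n) J"
begin

lemma admissible_at_dim: "pair_admissible CARD('n) (dim (L :: (real ^ 'n) set)) (J (dim L))"
  using J dim_subset_UNIV_cart[of L] by (simp add: admissible_uniformity_dims_def)

lemma resolvent_iff_rate_separated:
  "\<gamma> \<in> dichotomy_resolvent nrm T A J \<longleftrightarrow>
    (\<exists>L1 L2 r s. r < \<gamma> \<and> \<gamma> < s \<and> rate_separated L1 L2 (J (dim L1)) r s)"
  by (simp add: dichotomy_resolvent_def has_dichotomy_iff_rate_separated[OF admissible_at_dim])

lemma resolvent_obtain_stable:
  assumes "\<gamma> \<in> dichotomy_resolvent nrm T A J"
  obtains L r s where "r < \<gamma>" "\<gamma> < s"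
    "rate_separated (stable_set A \<gamma>) L (J (dim (stable_set A \<gamma>))) r s"
proof -
  obtain L1 L2 r s where *: "r < \<gamma>" "\<gamma> < s" "rate_separated L1 L2 (J (dim L1)) r s"
    using assms unfolding resolvent_iff_rate_separated by blast
  have "stable_set A \<gamma> = L1"
    using stable_set_eq_if_rate_separated[OF *(3) admissible_at_dim *(1,2)] .
  then show ?thesis using that * by blast
qed

text \<open>
  The dichotomy at \<open>\<gamma>\<close> is also one at each point between its two rates, with the same stable set.
\<close>

lemma dim_stable_set_constant:
  assumes I: "connected I" "I \<subseteq> dichotomy_resolvent nrm T A J" and "\<gamma> \<in> I" "\<delta> \<in> I"
  shows "dim (stable_set A \<gamma>) = dim (stable_set A \<delta>)"
proof (rule connected_local_const[OF I(1) assms(3,4)], intro ballI)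
  fix \<eta> assume "\<eta> \<in> I"
  then obtain L r s where *: "r < \<eta>" "\<eta> < s"
    "rate_separated (stable_set A \<eta>) L (J (dim (stable_set A \<eta>))) r s"
    using resolvent_obtain_stable I(2) by blast
  have "\<forall>\<^sub>F \<delta> in at \<eta> within I. \<delta> \<in> {r<..<s}"
    using * by (intro eventually_at_topological[THEN iffD2] exI[of _ "{r<..<s}"]) auto
  then show "\<forall>\<^sub>F \<delta> in at \<eta> within I. dim (stable_set A \<eta>) = dim (stable_set A \<delta>)"
  proof (rule eventually_mono)
    fix \<delta> assume "\<delta> \<in> {r<..<s}"
    then have "stable_set A \<delta> = stable_set A \<eta>"
      using stable_set_eq_if_rate_separated[OF *(3) admissible_at_dim] by auto
    then show "dim (stable_set A \<eta>) = dim (stable_set A \<delta>)" by simp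
  qed
qed

text \<open>
  In both of the following lemmas the first inequality uses the dichotomies in the gap arbitrarily
  close to the end point. For the second one, a single point of the gap suffices: one half of
  its dichotomy also holds at the end point, because the rate of that half lies strictly beyond it.
\<close>

lemma upper_limiting_bohl_eq:
  assumes "b < q" and gap: "{b<..<q} \<subseteq> dichotomy_resolvent nrm T A J"
    and k: "\<And>\<gamma>. \<gamma> \<in> {b<..<q} \<Longrightarrow> dim (stable_set A \<gamma>) = k"
    and b: "b \<notin> dichotomy_resolvent nrm T A J"
  shows "upper_limiting_bohl nrm T A k (fst (J k)) = ereal b"
proof (rule antisym)
  show "upper_limiting_bohl nrm T A k (fst (J k)) \<le> ereal b"
  proof (rule dense_ge_bounded)
    show "ereal b < ereal q" using assms(1) by simp
    fix w assume w: "ereal b < w" "w < ereal q"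
    then obtain \<gamma> where \<gamma>: "w = ereal \<gamma>" "b < \<gamma>" "\<gamma> < q" by (cases w) auto
    obtain L r s where *: "r < \<gamma>" "rate_separated (stable_set A \<gamma>) L (J k) r s"
      using resolvent_obtain_stable gap k \<gamma> by (metis greaterThanLessThan_iff subsetD)
    have "stable_set A \<gamma> \<in> grassmannian k UNIV"
      using * k \<gamma> by (simp add: grassmannian_def rate_separated_def)
    moreover have "(SUP U\<in>grassmannian (fst (J k)) (stable_set A \<gamma>). upper_bohl nrm T A U) \<le> w"
      unfolding \<gamma>(1) using * by (intro SUP_least upper_bohl_le[of _ r]) (auto simp: rate_separated_def)
    ultimately show "upper_limiting_bohl nrm T A k (fst (J k)) \<le> w"
      unfolding upper_limiting_bohl_def by (rule INF_lower2)
  qed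
  show "ereal b \<le> upper_limiting_bohl nrm T A k (fst (J k))"
  proof (rule ccontr)
    assume "\<not> ?thesis"
    then obtain L1 where L1: "L1 \<in> grassmannian k UNIV"
      "(SUP U\<in>grassmannian (fst (J k)) L1. upper_bohl nrm T A U) < ereal b"
      unfolding upper_limiting_bohl_def by (auto simp: INF_less_iff not_le)
    obtain r where r: "(SUP U\<in>grassmannian (fst (J k)) L1. upper_bohl nrm T A U) < ereal r" "r < b"
      using ereal_dense2[OF L1(2)] by auto
    have most: "grows_at_most U r" if "U \<in> grassmannian (fst (J k)) L1" for U
      using r(1) that by (intro grows_at_most_if_upper_bohl_less) (meson SUP_upper le_less_trans)
    obtain \<gamma> where \<gamma>: "b < \<gamma>" "\<gamma> < q" using dense[OF assms(1)] by blast
    obtain L2 r' s where *: "\<gamma> < s" "rate_separated (stable_set A \<gamma>) L2 (J k) r' s"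
      using resolvent_obtain_stable gap k \<gamma> by (metis greaterThanLessThan_iff subsetD)
    have "rate_separated L1 L2 (J (dim L1)) r s"
      using * most L1(1) k \<gamma> by (simp add: rate_separated_def grassmannian_def)
    then show False using b r(2) *(1) \<gamma>(1) unfolding resolvent_iff_rate_separated
      by (meson less_trans)
  qed
qed

lemma lower_limiting_bohl_eq:
  assumes "p < a" and gap: "{p<..<a} \<subseteq> dichotomy_resolvent nrm T A J"
    and k: "\<And>\<gamma>. \<gamma> \<in> {p<..<a} \<Longrightarrow> dim (stable_set A \<gamma>) = k"
    and a: "a \<notin> dichotomy_resolvent nrm T A J"
  shows "lower_limiting_bohl nrm T A k (snd (J k)) = ereal a"
proof (rule antisym)
  show "ereal a \<le> lower_limiting_bohl nrm T A k (snd (J k))"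
  proof (rule dense_le_bounded)
    show "ereal p < ereal a" using assms(1) by simp
    fix w assume w: "ereal p < w" "w < ereal a"
    then obtain \<gamma> where \<gamma>: "w = ereal \<gamma>" "p < \<gamma>" "\<gamma> < a" by (cases w) auto
    obtain L r s where *: "\<gamma> < s" "rate_separated (stable_set A \<gamma>) L (J k) r s"
      using resolvent_obtain_stable gap k \<gamma> by (metis greaterThanLessThan_iff subsetD)
    have "L \<in> grassmannian (CARD('n) - k) UNIV"
      using * k \<gamma> by (auto simp: grassmannian_def rate_separated_def)
    moreover have "w \<le> (INF U\<in>grassmannian (snd (J k)) L. lower_bohl nrm T A U)"
      unfolding \<gamma>(1) using * by (intro INF_greatest lower_bohl_ge[of _ s]) (auto simp: rate_separated_def)
    ultimately show "w \<le> lower_limiting_bohl nrm T A k (snd (J k))"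
      unfolding lower_limiting_bohl_def by (rule SUP_upper2)
  qed
  show "lower_limiting_bohl nrm T A k (snd (J k)) \<le> ereal a"
  proof (rule ccontr)
    assume "\<not> ?thesis"
    then obtain L2 where L2: "L2 \<in> grassmannian (CARD('n) - k) UNIV"
      "ereal a < (INF U\<in>grassmannian (snd (J k)) L2. lower_bohl nrm T A U)"
      unfolding lower_limiting_bohl_def by (auto simp: less_SUP_iff not_le)
    obtain s where s: "ereal s < (INF U\<in>grassmannian (snd (J k)) L2. lower_bohl nrm T A U)" "a < s"
      using ereal_dense2[OF L2(2)] by auto
    have least: "grows_at_least U s" if "U \<in> grassmannian (snd (J k)) L2" for U
      using s(1) that by (intro grows_at_least_if_less_lower_bohl) (meson INF_lower less_le_trans)
    obtain \<gamma> where \<gamma>: "p < \<gamma>" "\<gamma> < a" using dense[OF assms(1)] by blast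
    obtain L r s' where *: "r < \<gamma>" "rate_separated (stable_set A \<gamma>) L (J k) r s'"
      using resolvent_obtain_stable gap k \<gamma> by (metis greaterThanLessThan_iff subsetD)
    have dim: "dim (stable_set A \<gamma>) = k" using k \<gamma> by simp
    have "rate_separated (stable_set A \<gamma>) L2 (J (dim (stable_set A \<gamma>))) r s"
      using * least L2(1) dim by (auto simp: rate_separated_def grassmannian_def)
    then show False using a s(2) *(1) \<gamma>(2) unfolding resolvent_iff_rate_separated
      by (meson less_trans)
  qed
qed

end

end

section \<open>Spectral intervals\<close>

lemma spectral_gap_disjoint_intervals:
  assumes ab: "\<And>i. i \<in> {1..l} \<Longrightarrow> a i \<le> b i" and ba: "\<And>i. i \<in> {1..<l} \<Longrightarrow> b i < a (Suc i)"
    and i: "i \<le> l" and \<gamma>: "\<gamma> \<in> spectral_gap l a b i"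
  shows "\<gamma> \<notin> (\<Union>i\<in>{1..l}. {a i..b i})"
proof
  assume "\<gamma> \<in> (\<Union>i\<in>{1..l}. {a i..b i})"
  then obtain j where j: "1 \<le> j" "j \<le> l" "a j \<le> \<gamma>" "\<gamma> \<le> b j" by auto
  have mono_b: "b m \<le> b n" if "1 \<le> m" "m \<le> n" "n \<le> l" for m n
    using that(2,3)
  proof (induction n rule: dec_induct)
    case (step n)
    then show ?case using ab[of "Suc n"] ba[of n] that(1) by auto
  qed simp
  show False
  proof (cases "j \<le> i")
    case True
    then show False using mono_b[of j i] j i \<gamma> by (auto simp: spectral_gap_def)
  next
    case False
    then have "a (Suc i) \<le> a j"
    proof (cases "j = Suc i")
      case False
      then have "Suc i \<le> j - 1" "j = Suc (j - 1)" using \<open>\<not> j \<le> i\<close> by auto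
      then have "a (Suc i) \<le> b (Suc i)" "b (Suc i) \<le> b (j - 1)" "b (j - 1) < a j"
        using ab[of "Suc i"] mono_b[of "Suc i" "j - 1"] ba[of "j - 1"] j by auto
      then show ?thesis by linarith
    qed simp
    then show False using \<gamma> j False by (auto simp: spectral_gap_def)
  qed
qed

lemma connected_spectral_gap: "connected (spectral_gap l a b i)"
  unfolding is_interval_connected_1[symmetric] is_interval_1 spectral_gap_def by auto

theorem theorem30:
  fixes nrm :: "real ^ 'n \<Rightarrow> real"
    and T :: "int set"
    and A :: "int \<Rightarrow> real ^ 'n ^ 'n"
    and J :: "nat \<Rightarrow> nat \<times> nat"
    and l :: nat
    and a b :: "nat \<Rightarrow> real"
    and M :: "nat \<Rightarrow> (real ^ 'n) set"
  assumes "is_norm nrm"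
    and "bounded_system T A"
    and "admissible_uniformity_dims CARD('n) J"
    and "l \<in> {1..CARD('n)}"
    and "\<And>i. i \<in> {1..l} \<Longrightarrow> a i \<le> b i"
    and "\<And>i. i \<in> {1..<l} \<Longrightarrow> b i < a (Suc i)"
    and "dichotomy_spectrum nrm T A J = (\<Union>i\<in>{1..l}. {a i..b i})"
    and "\<And>i. i \<in> {0..l} \<Longrightarrow> \<exists>\<gamma>\<in>spectral_gap l a b i. M i = stable_set A \<gamma>"
  shows "\<forall>i\<in>{1..l}.
           ereal (a i) = lower_limiting_bohl nrm T A (dim (M (i - 1))) (snd (J (dim (M (i - 1))))) \<and>
           ereal (b i) = upper_limiting_bohl nrm T A (dim (M i)) (fst (J (dim (M i))))"
proof
  fix i assume i: "i \<in> {1..l}"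
  interpret bounded_difference_system nrm T A
    using assms(1,2) by unfold_locales
  note adm = assms(3)
  have gap: "spectral_gap l a b k \<subseteq> dichotomy_resolvent nrm T A J" if "k \<le> l" for k
  proof
    fix \<gamma> assume "\<gamma> \<in> spectral_gap l a b k"
    then have "\<gamma> \<notin> dichotomy_spectrum nrm T A J"
      unfolding assms(7) using spectral_gap_disjoint_intervals[of l a b k \<gamma>, OF assms(5,6) that] by blast
    then show "\<gamma> \<in> dichotomy_resolvent nrm T A J" by (simp add: dichotomy_spectrum_def)
  qed
  have dim: "dim (stable_set A \<gamma>) = dim (M k)" if k: "k \<le> l" and "\<gamma> \<in> spectral_gap l a b k" for k \<gamma>
  proof -
    obtain \<delta> where \<delta>: "\<delta> \<in> spectral_gap l a b k" "M k = stable_set A \<delta>"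
      using assms(8)[of k] k by auto
    have "dim (stable_set A \<gamma>) = dim (stable_set A \<delta>)"
      by (rule dim_stable_set_constant[OF adm connected_spectral_gap gap[OF k] that(2) \<delta>(1)])
    then show ?thesis by (simp add: \<delta>(2))
  qed
  have "a i \<le> b i" using i by (rule assms(5))
  then have "a i \<in> (\<Union>i\<in>{1..l}. {a i..b i})" "b i \<in> (\<Union>i\<in>{1..l}. {a i..b i})"
    using i by (auto intro!: bexI[of _ i])
  then have ends: "a i \<notin> dichotomy_resolvent nrm T A J" "b i \<notin> dichotomy_resolvent nrm T A J"
    unfolding assms(7)[symmetric] by (auto simp: dichotomy_spectrum_def)
  \<comment> \<open>The outermost gaps are unbounded; any bounded piece next to the spectrum serves.\<close>
  define q where "q = (if i = l then b i + 1 else a (Suc i))"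
  have q: "b i < q" "{b i<..<q} \<subseteq> spectral_gap l a b i"
    using i assms(6)[of i] by (auto simp: q_def spectral_gap_def)
  have upper: "upper_limiting_bohl nrm T A (dim (M i)) (fst (J (dim (M i)))) = ereal (b i)"
  proof (rule upper_limiting_bohl_eq[OF adm q(1)])
    show "{b i<..<q} \<subseteq> dichotomy_resolvent nrm T A J" using q(2) gap[of i] i by auto
    show "dim (stable_set A \<gamma>) = dim (M i)" if "\<gamma> \<in> {b i<..<q}" for \<gamma>
      using that q(2) dim[of i \<gamma>] i by auto
  qed (rule ends)
  have i': "i - 1 \<le> l" using i by auto
  define p where "p = (if i = 1 then a i - 1 else b (i - 1))"
  have "b (i - 1) < a i" if "i \<noteq> 1"
  proof -
    have "i - 1 \<in> {1..<l}" "Suc (i - 1) = i" using that i by auto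
    then show ?thesis using assms(6)[of "i - 1"] by simp
  qed
  then have p: "p < a i" "{p<..<a i} \<subseteq> spectral_gap l a b (i - 1)"
    using i by (auto simp: p_def spectral_gap_def)
  have lower: "lower_limiting_bohl nrm T A (dim (M (i - 1))) (snd (J (dim (M (i - 1)))))
      = ereal (a i)"
  proof (rule lower_limiting_bohl_eq[OF adm p(1)])
    show "{p<..<a i} \<subseteq> dichotomy_resolvent nrm T A J" using p(2) gap[OF i'] by blast
    show "dim (stable_set A \<gamma>) = dim (M (i - 1))" if "\<gamma> \<in> {p<..<a i}" for \<gamma>
      using p(2) dim[OF i'] that by blast
  qed (rule ends)
  show "ereal (a i) = lower_limiting_bohl nrm T A (dim (M (i - 1))) (snd (J (dim (M (i - 1))))) \<and>
        ereal (b i) = upper_limiting_bohl nrm T A (dim (M i)) (fst (J (dim (M i))))"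
    using upper lower by simp
qed

end
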